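(* If $n$ is a positive integer and $p$ is a non-zero integer, then $$\sum_{k=0}^n(-1)^{n-k}\frac{n}{n+k}\binom{n+k}{n-k}\left(\frac{2L_{2p}}{\sqrt5F_{2p}}\right)^{2k}=\frac12\left(\Bigl(\frac{\sqrt5F_p}{L_p}\Bigr)^{2n}+\Bigl(\frac{L_p}{\sqrt5F_p}\Bigr)^{2n}\right).$$
   Context: $F_n$ and $L_n$ ($n\in\mathbb{Z}$) are the Fibonacci and Lucas numbers: $F_0=0$, $F_1=1$, $F_n=F_{n-1}+F_{n-2}$; $L_0=2$, $L_1=1$, $L_n=L_{n-1}+L_{n-2}$, extended to negative indices by $F_{-n}=(-1)^{n-1}F_n$, $L_{-n}=(-1)^nL_n$. *)

theory Defs
  imports Complex_Main "HOL-Number_Theory.Fib"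
begin

fun lucas :: "nat \<Rightarrow> nat" where
  "lucas 0 = 2"
| "lucas (Suc 0) = 1"
| "lucas (Suc (Suc n)) = lucas (Suc n) + lucas n"

definition fib_int :: "int \<Rightarrow> int" where
  "fib_int m =
     (if m \<ge> 0 then int (fib (nat m)) else (- 1) ^ (nat (- m) - 1) * int (fib (nat (- m))))"

definition lucas_int :: "int \<Rightarrow> int" where
  "lucas_int m =
     (if m \<ge> 0 then int (lucas (nat m)) else (- 1) ^ nat (- m) * int (lucas (nat (- m))))"

end

theory Submission
  imports Defs
begin

text \<open>
  Put \<open>a = \<surd>5 F\<^sub>p / L\<^sub>p\<close>. The duplication formulas \<open>F\<^bsub>2p\<^esub> = F\<^sub>p L\<^sub>p\<close> and
  \<open>2 L\<^bsub>2p\<^esub> = 5 F\<^sub>p\<^sup>2 + L\<^sub>p\<^sup>2\<close> show that the base of the powers on the left is \<open>a + 1/a\<close>, so the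
  claim is the expansion of \<open>a\<^bsup>2n\<^esup> + a\<^bsup>-2n\<^esup>\<close> in powers of \<open>(a + 1/a)\<^sup>2\<close>, a Chebyshev polynomial
  identity. Its coefficients split as \<open>2n/(n+k) C(n+k,2k) = C(n+k,2k) + C(n+k-1,2k)\<close>, so it is a
  difference of two consecutive Morgan-Voyce sums, and these obey a two-term recurrence by
  Pascal's rule.
\<close>

text \<open>Up to the factor \<open>(- 1) ^ n\<close>, the Morgan-Voyce polynomial at
  \<open>- y\<close>; for \<open>y = x\<^sup>2\<close> this is the Chebyshev value
  \<open>U_{2n}(x/2)\<close>, and \<open>x * morgan_B y n\<close> is
  \<open>U_{2n+1}(x/2)\<close>.\<close>

definition morgan_b :: "'a::comm_ring_1 \<Rightarrow> nat \<Rightarrow> 'a" where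
  "morgan_b y n = (\<Sum>k\<le>n. (- 1) ^ (n + k) * of_nat ((n + k) choose (2 * k)) * y ^ k)"

definition morgan_B :: "'a::comm_ring_1 \<Rightarrow> nat \<Rightarrow> 'a" where
  "morgan_B y n = (\<Sum>k\<le>n. (- 1) ^ (n + k) * of_nat ((n + k + 1) choose (2 * k + 1)) * y ^ k)"

lemma morgan_b_Suc: "morgan_b y (Suc n) = y * morgan_B y n - morgan_b y n"
proof -
  \<comment> \<open>The added term \<open>k = Suc n\<close> is zero, so both sums range over the
    same indices.\<close>
  have b: "morgan_b y n = (\<Sum>k\<le>Suc n. (- 1) ^ (n + k) * of_nat ((n + k) choose (2 * k)) * y ^ k)"
    by (simp add: morgan_b_def binomial_eq_0)
  have "morgan_b y (Suc n) + morgan_b y n =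
      (\<Sum>k\<le>Suc n. (- 1) ^ (n + k) *
         (of_nat ((n + k) choose (2 * k)) - of_nat (Suc (n + k) choose (2 * k))) * y ^ k)"
    unfolding b by (simp add: morgan_b_def sum.distrib[symmetric] algebra_simps)
  also have "\<dots> = y * morgan_B y n"
    \<comment> \<open>At \<open>k = 0\<close> the binomials cancel; after the shift, Pascal's rule
      leaves \<open>(n + k + 1) choose (2 * k + 1)\<close> and one factor \<open>y\<close>.\<close>
    unfolding sum.atMost_Suc_shift
    by (simp add: morgan_B_def sum_distrib_left algebra_simps)
  finally show ?thesis
    by (simp add: algebra_simps)
qed

lemma morgan_B_Suc: "morgan_B y (Suc n) = morgan_b y (Suc n) - morgan_B y n"
proof -
  have B: "morgan_B y n =
      (\<Sum>k\<le>Suc n. (- 1) ^ (n + k) * of_nat ((n + k + 1) choose (2 * k + 1)) * y ^ k)"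
    by (simp add: morgan_B_def binomial_eq_0)
  show ?thesis
    unfolding B morgan_B_def[of _ "Suc n"] morgan_b_def sum_subtractf[symmetric]
    by (rule sum.cong) (simp_all add: algebra_simps)
qed

lemma power_sum_recurrence:
  fixes a b :: "'a::comm_ring_1"
  assumes "a * b = 1"
  shows "(a + b) * (a ^ Suc m + b ^ Suc m) - (a ^ m + b ^ m) = a ^ Suc (Suc m) + b ^ Suc (Suc m)"
proof -
  have "(a + b) * (a ^ Suc m + b ^ Suc m) =
      a ^ Suc (Suc m) + b ^ Suc (Suc m) + (a * b) * (a ^ m + b ^ m)"
    by (simp add: algebra_simps)
  then show ?thesis by (simp add: assms)
qed

text \<open>The differences for \<open>morgan_b\<close> and \<open>morgan_B\<close> interleave as
  the even and odd terms of one sequence with \<open>s (j + 2) = x * s (j + 1) - s j\<close>, which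
  the power sums also satisfy. Each parity feeds the other, hence the joint induction.\<close>

lemma morgan_diff:
  fixes a b :: "'a::comm_ring_1"
  assumes ab: "a * b = 1"
  defines "x \<equiv> a + b"
  shows "morgan_b (x\<^sup>2) (Suc n) - morgan_b (x\<^sup>2) n = a ^ (2 * n + 2) + b ^ (2 * n + 2)"
    and "x * (morgan_B (x\<^sup>2) (Suc n) - morgan_B (x\<^sup>2) n) = a ^ (2 * n + 3) + b ^ (2 * n + 3)"
proof (induction n)
  case 0
  {
    case 1
    have "morgan_b (x\<^sup>2) 1 - morgan_b (x\<^sup>2) 0 = x * x - 2"
      by (simp add: morgan_b_def power2_eq_square numeral_eq_Suc)
    then show ?case
      using power_sum_recurrence[OF ab, folded x_def, of 0] by (simp add: x_def algebra_simps power2_eq_square)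
  next
    case 2
    have "x * (morgan_B (x\<^sup>2) 1 - morgan_B (x\<^sup>2) 0) = x * (x * x - 2) - x"
      by (simp add: morgan_B_def power2_eq_square algebra_simps numeral_eq_Suc)
    also have "x * x - 2 = a\<^sup>2 + b\<^sup>2"
      using power_sum_recurrence[OF ab, folded x_def, of 0] by (simp add: x_def power2_eq_square)
    also have "x * (a\<^sup>2 + b\<^sup>2) - x = a ^ (2 * 0 + 3) + b ^ (2 * 0 + 3)"
      using power_sum_recurrence[OF ab, folded x_def, of 1] by (simp add: x_def numeral_eq_Suc)
    finally show ?case by simp
  }
next
  case (Suc n)
  have "morgan_b (x\<^sup>2) (Suc (Suc n)) - morgan_b (x\<^sup>2) (Suc n) =
      x * (x * (morgan_B (x\<^sup>2) (Suc n) - morgan_B (x\<^sup>2) n))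
      - (morgan_b (x\<^sup>2) (Suc n) - morgan_b (x\<^sup>2) n)"
    by (simp only: morgan_b_Suc[of _ "Suc n"] morgan_b_Suc[of _ n])
      (simp add: algebra_simps power2_eq_square)
  also have "\<dots> = a ^ (2 * Suc n + 2) + b ^ (2 * Suc n + 2)"
    using power_sum_recurrence[OF ab, folded x_def, of "2 * n + 2"] by (simp only: Suc) (simp add: numeral_eq_Suc)
  finally have b: "morgan_b (x\<^sup>2) (Suc (Suc n)) - morgan_b (x\<^sup>2) (Suc n) =
      a ^ (2 * Suc n + 2) + b ^ (2 * Suc n + 2)" .
  {
    case 1
    show ?case by (fact b)
  next
    case 2
    have "x * (morgan_B (x\<^sup>2) (Suc (Suc n)) - morgan_B (x\<^sup>2) (Suc n)) =
        x * (morgan_b (x\<^sup>2) (Suc (Suc n)) - morgan_b (x\<^sup>2) (Suc n))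
        - x * (morgan_B (x\<^sup>2) (Suc n) - morgan_B (x\<^sup>2) n)"
      by (simp only: morgan_B_Suc[of _ "Suc n"] morgan_B_Suc[of _ n]) (simp add: algebra_simps)
    also have "\<dots> = a ^ (2 * Suc n + 3) + b ^ (2 * Suc n + 3)"
      using power_sum_recurrence[OF ab, folded x_def, of "2 * n + 3"] by (simp only: b Suc) (simp add: numeral_eq_Suc)
    finally show ?case .
  }
qed

text \<open>Absorption gives \<open>(n - k) C(n+k, 2k) = (n + k) C(n+k-1, 2k)\<close>; adding
  \<open>(n + k) C(n+k, 2k)\<close> to both sides yields \<open>2 n C(n+k, 2k)\<close> on the
  left.\<close>

lemma chebyshev_coeff:
  fixes n k :: nat
  assumes "n > 0" "k \<le> n"
  shows "2 * (real n / real (n + k)) * real ((n + k) choose (n - k)) =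
    real ((n + k) choose (2 * k)) + real ((n + k - 1) choose (2 * k))"
proof -
  have sym: "(n + k) choose (n - k) = (n + k) choose (2 * k)"
    using assms binomial_symmetric[of "2 * k" "n + k"] by (simp add: mult_2)
  have "real (n + k - 2 * k) * real ((n + k) choose (2 * k)) =
      real (n + k) * real ((n + k - 1) choose (2 * k))"
    by (metis binomial_absorb_comp of_nat_mult)
  then have "(real n - real k) * real ((n + k) choose (2 * k)) =
      real (n + k) * real ((n + k - 1) choose (2 * k))"
    using assms by (simp add: of_nat_diff)
  then show ?thesis
    unfolding sym using assms by (simp add: field_simps)
qed

lemma chebyshev_expansion:
  fixes a :: real
  assumes "n > 0" "a \<noteq> 0"
  shows "(\<Sum>k=0..n. (- 1) ^ (n - k) * (real n / real (n + k)) * real ((n + k) choose (n - k))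
            * (a + 1 / a) ^ (2 * k)) = 1 / 2 * (a ^ (2 * n) + (1 / a) ^ (2 * n))"
    (is "?S = _")
proof -
  obtain m where m: "n = Suc m"
    using assms(1) gr0_implies_Suc by blast
  define y where "y = (a + 1 / a)\<^sup>2"
  have "2 * ?S = (\<Sum>k\<le>n. (- 1) ^ (n - k) *
      (2 * (real n / real (n + k)) * real ((n + k) choose (n - k))) * y ^ k)"
    by (simp add: sum_distrib_left y_def atMost_atLeast0 mult_ac flip: power_mult)
  also have "\<dots> = (\<Sum>k\<le>n. (- 1) ^ (n + k) *
      (real ((n + k) choose (2 * k)) + real ((n + k - 1) choose (2 * k))) * y ^ k)"
  proof (rule sum.cong)
    fix k assume "k \<in> {..n}"
    then have k: "k \<le> n" by simp
    \<comment> \<open>The exponents differ by \<open>2 * k\<close>; the form \<open>n + k\<close>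
      avoids truncated subtraction.\<close>
    have "(- 1) ^ (n - k) = ((- 1) ^ (n + k) :: real)"
      using k by (auto simp: uminus_power_if)
    then show "(- 1) ^ (n - k) * (2 * (real n / real (n + k)) * real ((n + k) choose (n - k))) * y ^ k
        = (- 1) ^ (n + k) * (real ((n + k) choose (2 * k)) + real ((n + k - 1) choose (2 * k))) * y ^ k"
      using chebyshev_coeff[OF assms(1) k] by simp
  qed simp
  also have "\<dots> = morgan_b y (Suc m) - morgan_b y m"
  proof -
    \<comment> \<open>Since \<open>n + k - 1 = m + k\<close>, the second binomials belong to
      \<open>morgan_b y m\<close>; the exponent \<open>n + k\<close> exceeds \<open>m + k\<close> by
      one, hence the minus sign.\<close>
    have "morgan_b y m = (\<Sum>k\<le>Suc m. (- 1) ^ (m + k) * of_nat ((m + k) choose (2 * k)) * y ^ k)"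
      by (simp add: morgan_b_def binomial_eq_0)
    then show ?thesis
      unfolding m morgan_b_def[of y "Suc m"]
      by (simp only: sum_subtractf[symmetric]) (rule sum.cong, simp_all add: algebra_simps)
  qed
  also have "\<dots> = a ^ (2 * n) + (1 / a) ^ (2 * n)"
    unfolding y_def using morgan_diff(1)[of a "1 / a" m] assms(2) by (simp add: m)
  finally show ?thesis by simp
qed

lemma lucas_eq_fib: "int (lucas n) = 2 * int (fib (Suc n)) - int (fib n)"
  by (induction n rule: lucas.induct) auto

text \<open>Joint induction: each step of the Fibonacci recurrence needs the values at both
  \<open>2 * n\<close> and \<open>2 * n + 1\<close>.\<close>

lemma fib_double: "int (fib (2 * n)) = int (fib n) * int (lucas n)"
  and fib_double_Suc: "int (fib (Suc (2 * n))) = (int (fib n))\<^sup>2 + (int (fib (Suc n)))\<^sup>2"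
  by (induction n) (auto simp: lucas_eq_fib power2_eq_square algebra_simps)

lemma lucas_double: "2 * int (lucas (2 * n)) = 5 * (int (fib n))\<^sup>2 + (int (lucas n))\<^sup>2"
  unfolding lucas_eq_fib[of "2 * n"] fib_double fib_double_Suc
  by (simp add: lucas_eq_fib power2_eq_square algebra_simps)

lemma lucas_pos: "lucas n > 0"
  by (induction n rule: lucas.induct) auto

text \<open>The sign \<open>- ((- 1) ^ m)\<close> avoids the truncated exponent
  \<open>m - 1\<close>; it is harmless at \<open>m = 0\<close> because
  \<open>fib 0 = 0\<close>.\<close>

lemma fib_int_minus: "fib_int (- int m) = - ((- 1) ^ m) * int (fib m)"
  by (cases m) (auto simp: fib_int_def nat_add_distrib)

lemma lucas_int_minus: "lucas_int (- int m) = (- 1) ^ m * int (lucas m)"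
  by (cases m) (auto simp: lucas_int_def nat_add_distrib)

lemma fib_int_of_nat: "fib_int (int m) = int (fib m)"
  by (simp add: fib_int_def)

lemma lucas_int_of_nat: "lucas_int (int m) = int (lucas m)"
  by (simp add: lucas_int_def)

lemma fib_int_double: "fib_int (2 * p) = fib_int p * lucas_int p"
proof (cases p rule: int_cases2)
  case (nonneg m)
  then show ?thesis
    using fib_int_of_nat[of "2 * m"] by (simp add: fib_int_of_nat lucas_int_of_nat fib_double)
next
  case (nonpos m)
  then show ?thesis
    using fib_int_minus[of "2 * m"]
    by (simp add: fib_int_minus lucas_int_minus fib_double flip: power_add mult_2)
qed

text \<open>For negative \<open>p\<close> the squares absorb the signs on the right, and the even
  index leaves none on the left.\<close>

lemma lucas_int_double: "2 * lucas_int (2 * p) = 5 * (fib_int p)\<^sup>2 + (lucas_int p)\<^sup>2"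
proof (cases p rule: int_cases2)
  case (nonneg m)
  then show ?thesis
    using lucas_int_of_nat[of "2 * m"] by (simp add: fib_int_of_nat lucas_int_of_nat lucas_double)
next
  case (nonpos m)
  then show ?thesis
    using lucas_int_minus[of "2 * m"]
    by (simp add: fib_int_minus lucas_int_minus lucas_double power_mult_distrib flip: power_mult)
qed

lemma fib_int_nonzero: "p \<noteq> 0 \<Longrightarrow> fib_int p \<noteq> 0"
  by (cases p rule: int_cases2) (auto simp: fib_int_of_nat fib_int_minus fib_neq_0_nat)

lemma lucas_int_nonzero: "lucas_int p \<noteq> 0"
  by (cases p rule: int_cases2) (simp_all add: lucas_int_of_nat lucas_int_minus lucas_pos[THEN gr_implies_not0])

theorem theorem11:
  fixes n :: nat and p :: int
  assumes "n > 0" and "p \<noteq> 0"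
  shows "(\<Sum>k=0..n. (- 1) ^ (n - k) * (real n / real (n + k)) * real ((n + k) choose (n - k))
            * (2 * real_of_int (lucas_int (2 * p)) / (sqrt 5 * real_of_int (fib_int (2 * p)))) ^ (2 * k))
         = 1 / 2 * ((sqrt 5 * real_of_int (fib_int p) / real_of_int (lucas_int p)) ^ (2 * n)
                    + (real_of_int (lucas_int p) / (sqrt 5 * real_of_int (fib_int p))) ^ (2 * n))"
proof -
  define F where "F = real_of_int (fib_int p)"
  define L where "L = real_of_int (lucas_int p)"
  define a where "a = sqrt 5 * F / L"
  have nz: "F \<noteq> 0" "L \<noteq> 0"
    using assms(2) by (simp_all add: F_def L_def fib_int_nonzero lucas_int_nonzero)
  have L2: "2 * real_of_int (lucas_int (2 * p)) = 5 * F\<^sup>2 + L\<^sup>2"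
    using arg_cong[OF lucas_int_double[of p], of real_of_int] by (simp add: F_def L_def)
  have F2: "real_of_int (fib_int (2 * p)) = F * L"
    by (simp add: fib_int_double F_def L_def)
  \<comment> \<open>Over a common denominator, \<open>a + 1 / a\<close> is
    \<open>(5 * F\<^sup>2 + L\<^sup>2) / (sqrt 5 * F * L)\<close>.\<close>
  have base: "2 * real_of_int (lucas_int (2 * p)) / (sqrt 5 * real_of_int (fib_int (2 * p))) = a + 1 / a"
    unfolding L2 F2 a_def using nz by (simp add: field_simps power2_eq_square)
  have "1 / a = L / (sqrt 5 * F)" "a \<noteq> 0"
    using nz by (simp_all add: a_def)
  then show ?thesis
    using chebyshev_expansion[OF assms(1), of a] unfolding base
    by (simp only: \<open>1 / a = L / (sqrt 5 * F)\<close>) (simp add: a_def F_def L_def)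
qed

end
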